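(* Let $n\ge1$. There is a constant $C$ depending only on $n$ such that if $f$ is in $H^1(\gamma)$ on $\mathbb{R}^n$, then $\mathcal{M}_{\mathrm{loc}}f\in L^1(\gamma)$ and $$\|\mathcal{M}_{\mathrm{loc}}f\|_{L^1(\gamma)}\le C\,\|f\|_{H^1(\gamma)}.$$
   Context: $\gamma$ is the Gauss measure on $\mathbb{R}^n$, with density $\gamma_0(x)=\pi^{-n/2}e^{-|x|^2}$ with respect to Lebesgue measure. A closed Euclidean ball $B$ with radius $r_B$ and centre $c_B$ is called admissible if $r_B\le\min(1,1/|c_B|)$ (where $\min(1,1/|x|)=1$ for $x=0$). A Gaussian atom is either the constant function $1$ or a function $a\in L^\infty(\gamma)$ supported in an admissible ball $B$ with $\int a\,d\gamma=0$ and $\|a\|_\infty\le\gamma(B)^{-1}$. $H^1(\gamma)$ is the space of all $f\in L^1(\gamma)$ that admit a decomposition $f=\sum_j\lambda_j a_j$ with $a_j$ Gaussian atoms and $(\lambda_j)$ a summable sequence of complex numbers; $\|f\|_{H^1(\gamma)}$ is the infimum of $\sum_j|\lambda_j|$ over all such representations. Let $\Phi=\{\phi\in C_c^1(B(0,1)):\ |D^\alpha\phi|\le1\ \text{for}\ |\alpha|=0,1\}$ and $\phi_t(x)=t^{-n}\phi(x/t)$. The local grand maximal function is $$\mathcal{M}_{\mathrm{loc}}f(x)=\sup\{|\phi_t*f(x)|:\ \phi\in\Phi,\ 0<t<\min(1,1/|x|)\},$$ where the convolution is taken with respect to Lebesgue measure. *)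

theory Defs
  imports "HOL-Probability.Probability"
begin

definition gauss_density :: "real ^ 'n \<Rightarrow> real" where
  "gauss_density x = pi powr (- real CARD('n) / 2) * exp (- (norm x)\<^sup>2)"

definition gauss_measure :: "(real ^ 'n) measure" where
  "gauss_measure = density lborel (\<lambda>x. ennreal (gauss_density x))"

text \<open>The case distinction is needed because division by zero would give the value \<open>0\<close>
  at the origin, where \<open>min(1, 1/|x|)\<close> is to be read as \<open>1\<close>.\<close>

definition adm :: "real ^ 'n \<Rightarrow> real" where
  "adm x = (if x = 0 then 1 else min 1 (1 / norm x))"

definition admissible_ball :: "(real ^ 'n) set \<Rightarrow> bool" where
  "admissible_ball B \<longleftrightarrow> (\<exists>c r. 0 < r \<and> r \<le> adm c \<and> B = cball c r)"

text \<open>Elements of \<open>L\<^sup>p(\<gamma>)\<close> are represented by Borel functions; the support and norm conditions are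
  therefore imposed up to \<open>\<gamma>\<close>-null sets.\<close>

definition gauss_atom :: "(real ^ 'n \<Rightarrow> complex) \<Rightarrow> bool" where
  "gauss_atom a \<longleftrightarrow> a = (\<lambda>_. 1) \<or>
     (\<exists>B. admissible_ball B \<and>
        a \<in> borel_measurable gauss_measure \<and>
        (AE x in gauss_measure. x \<notin> B \<longrightarrow> a x = 0) \<and>
        (\<integral>x. a x \<partial>gauss_measure) = 0 \<and>
        esssup gauss_measure (\<lambda>x. ereal (norm (a x))) \<le> ereal (1 / measure gauss_measure B))"

text \<open>The series \<open>\<Sum>\<^sub>j \<lambda>\<^sub>j a\<^sub>j\<close> is understood as an \<open>L\<^sup>1(\<gamma>)\<close>-limit of its partial sums. As atoms
  lie in the unit ball of \<open>L\<^sup>1(\<gamma>)\<close>, this is the same as convergence \<open>\<gamma>\<close>-almost everywhere.\<close>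

definition atomic_rep ::
    "(real ^ 'n \<Rightarrow> complex) \<Rightarrow> (nat \<Rightarrow> complex) \<Rightarrow> (nat \<Rightarrow> real ^ 'n \<Rightarrow> complex) \<Rightarrow> bool" where
  "atomic_rep f l a \<longleftrightarrow>
     (\<forall>j. gauss_atom (a j)) \<and>
     summable (\<lambda>j. norm (l j)) \<and>
     (\<lambda>N. \<integral>x. norm (f x - (\<Sum>j<N. l j * a j x)) \<partial>gauss_measure) \<longlonglongrightarrow> 0"

definition H1_gauss :: "(real ^ 'n \<Rightarrow> complex) set" where
  "H1_gauss = {f. integrable gauss_measure f \<and> (\<exists>l a. atomic_rep f l a)}"

definition H1_norm :: "(real ^ 'n \<Rightarrow> complex) \<Rightarrow> real" where
  "H1_norm f = Inf {(\<Sum>j. norm (l j)) | l a. atomic_rep f l a}"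

definition partial_deriv :: "'n \<Rightarrow> (real ^ 'n \<Rightarrow> complex) \<Rightarrow> real ^ 'n \<Rightarrow> complex" where
  "partial_deriv i \<phi> x = frechet_derivative \<phi> (at x) (axis i 1)"

definition C1_compact_support :: "(real ^ 'n) set \<Rightarrow> (real ^ 'n \<Rightarrow> complex) set" where
  "C1_compact_support U = {\<phi>.
     (\<forall>x. \<phi> differentiable (at x)) \<and>
     (\<forall>i. continuous_on UNIV (partial_deriv i \<phi>)) \<and>
     compact (closure {x. \<phi> x \<noteq> 0}) \<and> closure {x. \<phi> x \<noteq> 0} \<subseteq> U}"

definition test_functions :: "(real ^ 'n \<Rightarrow> complex) set" where
  "test_functions = {\<phi> \<in> C1_compact_support (ball 0 1).
     (\<forall>x. norm (\<phi> x) \<le> 1) \<and> (\<forall>i x. norm (partial_deriv i \<phi> x) \<le> 1)}"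

definition dilation :: "real \<Rightarrow> (real ^ 'n \<Rightarrow> complex) \<Rightarrow> real ^ 'n \<Rightarrow> complex" where
  "dilation t \<phi> x = (1 / t ^ CARD('n)) *\<^sub>R \<phi> (x /\<^sub>R t)"

definition lebesgue_conv ::
    "(real ^ 'n \<Rightarrow> complex) \<Rightarrow> (real ^ 'n \<Rightarrow> complex) \<Rightarrow> real ^ 'n \<Rightarrow> complex" where
  "lebesgue_conv g f x = (\<integral>y. g (x - y) * f y \<partial>lborel)"

text \<open>The supremum may be infinite at individual points, so it is taken in the extended
  nonnegative reals.\<close>

definition M_loc :: "(real ^ 'n \<Rightarrow> complex) \<Rightarrow> real ^ 'n \<Rightarrow> ennreal" where
  "M_loc f x = Sup {ennreal (norm (lebesgue_conv (dilation t \<phi>) f x)) | \<phi> t.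
     \<phi> \<in> test_functions \<and> 0 < t \<and> t < adm x}"

end

theory Submission imports Defs begin

text \<open>
  The local grand maximal function is sublinear, so everything rests on one uniform estimate:
  \<open>\<integral> M_loc a d\<gamma> \<le> C\<close> for every Gaussian atom \<open>a\<close>. For the constant atom it holds because the
  \<open>L\<^sup>1\<close> norm of \<open>\<phi>\<^sub>t\<close> for Lebesgue measure is bounded and the Gauss measure is finite.

  Let \<open>a\<close> be an atom on an admissible ball with centre \<open>c\<close> and radius \<open>r\<close>, and write \<open>d = |x - c|\<close>. The
  argument is the classical one for Hardy spaces, and works because at the admissible scale the
  Gaussian density is essentially constant (\<open>gauss_density_comparable\<close>). For \<open>d < 2 r\<close> the size
  condition gives \<open>M_loc a(x) \<le> K / (\<gamma>\<^sub>0(c) r\<^sup>n)\<close>. For \<open>d \<ge> 2 r\<close> only scales \<open>t > d / 2\<close> contribute;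
  as \<open>t\<close> is smaller than \<open>1\<close> and \<open>1 / |x|\<close>, this bounds \<open>d (1 + |c|)\<close>, and the densities at \<open>x\<close> and
  \<open>c\<close> are comparable. The atom has mean zero with respect to the Gauss measure, so the convolution
  has to be read as integration against \<open>\<phi>\<^sub>t(x - y) / \<gamma>\<^sub>0(y)\<close>, and the increment of this kernel between \<open>c\<close> and a point
  of the ball is of order \<open>r / (\<gamma>\<^sub>0(c) t\<^sup>n\<^sup>+\<^sup>1)\<close> (\<open>gauss_kernel_diff_le\<close>). Hence \<open>M_loc a\<close> decays like
  \<open>r / (\<gamma>\<^sub>0(c) d\<^sup>n\<^sup>+\<^sup>1)\<close> (\<open>lebesgue_conv_cancelling_bounds\<close>), and a dyadic summation
  (\<open>nn_integral_radial_tail_le\<close>) yields a bound independent of the ball.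

  The passage from atoms to \<open>f\<close> uses that each \<open>\<phi>\<^sub>t * f(x)\<close> depends continuously on \<open>f\<close> in \<open>L\<^sup>1(\<gamma>)\<close>
  (\<open>M_loc_countably_subadditive\<close>), and measurability of \<open>M_loc f\<close> follows from its lower
  semicontinuity (\<open>borel_measurable_M_loc\<close>).
\<close>

section \<open>The Gauss measure and test functions\<close>

lemma sets_gauss_measure [measurable_cong, simp]: "sets gauss_measure = sets borel"
  by (simp add: gauss_measure_def)

lemma space_gauss_measure [simp]: "space gauss_measure = UNIV"
  by (simp add: gauss_measure_def)

lemma gauss_density_pos: "0 < gauss_density x"
  by (simp add: gauss_density_def)

lemma gauss_density_measurable [measurable]: "gauss_density \<in> borel_measurable borel"
  unfolding gauss_density_def[abs_def] by measurable

text \<open>The density is a product of one-dimensional Gaussians in the coordinates, each of integral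
  \<open>\<surd>\<pi>\<close>, and the normalising factor cancels the product of these integrals.\<close>

lemma emeasure_gauss_measure_UNIV: "emeasure (gauss_measure :: (real ^ 'n) measure) UNIV = 1"
proof -
  have one: "(\<integral>\<^sup>+ s. ennreal (exp (- s\<^sup>2)) \<partial>lborel) = ennreal (sqrt pi)"
  proof -
    have eq: "exp (- s\<^sup>2) = sqrt pi * normal_density 0 (1 / sqrt 2) s" for s
      by (simp add: normal_density_def power_divide)
    show ?thesis
      unfolding eq by (subst nn_integral_eq_integral) auto
  qed
  have "emeasure (gauss_measure :: (real ^ 'n) measure) UNIV = (\<integral>\<^sup>+ x. ennreal (pi powr (- real CARD('n) / 2)) * (\<Prod>b\<in>Basis. ennreal (exp (- (x \<bullet> b)\<^sup>2))) \<partial>(lborel :: (real ^ 'n) measure))"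
    unfolding gauss_measure_def
  proof (subst emeasure_density)
    show "(\<integral>\<^sup>+ x. ennreal (gauss_density x) * indicator UNIV x \<partial>(lborel :: (real ^ 'n) measure)) = (\<integral>\<^sup>+ x. ennreal (pi powr (- real CARD('n) / 2)) * (\<Prod>b\<in>Basis. ennreal (exp (- (x \<bullet> b)\<^sup>2))) \<partial>(lborel :: (real ^ 'n) measure))"
    proof (rule nn_integral_cong)
      fix x :: "real ^ 'n"
      have "(norm x)\<^sup>2 = (\<Sum>b\<in>Basis. (x \<bullet> b)\<^sup>2)"
        unfolding power2_norm_eq_inner by (subst euclidean_inner) (simp add: power2_eq_square)
      then show "ennreal (gauss_density x) * indicator UNIV x = ennreal (pi powr (- real CARD('n) / 2)) * (\<Prod>b\<in>Basis. ennreal (exp (- (x \<bullet> b)\<^sup>2)))"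
        by (simp add: gauss_density_def ennreal_mult' exp_sum[symmetric] sum_negf[symmetric] prod_ennreal)
    qed
  qed auto
  also have "\<dots> = ennreal (pi powr (- real CARD('n) / 2)) * (\<integral>\<^sup>+ x. (\<Prod>b\<in>Basis. ennreal (exp (- (x \<bullet> b)\<^sup>2))) \<partial>(lborel :: (real ^ 'n) measure))"
    by (rule nn_integral_cmult) measurable
  also have "(\<integral>\<^sup>+ x. (\<Prod>b\<in>Basis. ennreal (exp (- (x \<bullet> b)\<^sup>2))) \<partial>(lborel :: (real ^ 'n) measure)) = ennreal (sqrt pi ^ CARD('n))"
    by (subst nn_integral_lborel_prod) (auto simp: one prod_ennreal ennreal_power)
  also have "ennreal (pi powr (- real CARD('n) / 2)) * ennreal (sqrt pi ^ CARD('n)) = 1"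
  proof -
    have "sqrt pi ^ CARD('n) = pi powr (real CARD('n) / 2)"
      by (simp add: powr_half_sqrt[symmetric] powr_realpow[symmetric] powr_powr)
    then show ?thesis
      by (simp add: ennreal_mult'[symmetric] powr_add[symmetric])
  qed
  finally show ?thesis .
qed

lemma prob_space_gauss_measure: "prob_space (gauss_measure :: (real ^ 'n) measure)"
  by (rule prob_spaceI) (simp add: emeasure_gauss_measure_UNIV)

lemma gauss_density_eq_mult_exp:
  fixes y c :: "real ^ 'n"
  shows "gauss_density y = gauss_density c * exp ((norm c)\<^sup>2 - (norm y)\<^sup>2)"
  by (simp add: gauss_density_def exp_diff exp_minus field_simps)

lemma abs_norm_sq_diff_le:
  fixes y c :: "'a::real_normed_vector"
  shows "\<bar>(norm y)\<^sup>2 - (norm c)\<^sup>2\<bar> \<le> norm (y - c) * (2 * norm c + norm (y - c))"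
proof -
  have "\<bar>(norm y)\<^sup>2 - (norm c)\<^sup>2\<bar> = \<bar>norm y - norm c\<bar> * (norm y + norm c)"
    by (simp add: square_diff_square_factored power2_eq_square abs_mult mult.commute)
  also have "\<dots> \<le> norm (y - c) * (2 * norm c + norm (y - c))"
    using norm_triangle_ineq3[of y c] norm_triangle_sub[of y c]
    by (intro mult_mono) auto
  finally show ?thesis .
qed

text \<open>The Gaussian density varies only by a constant factor over distances \<open>d\<close> from \<open>c\<close> for which
  \<open>d |c|\<close> and \<open>d\<close> are bounded. This is what makes the measure doubling at the admissible scale.\<close>

lemma gauss_density_comparable:
  fixes y c :: "real ^ 'n"
  assumes "norm (y - c) * (2 * norm c + norm (y - c)) \<le> m"
  shows "gauss_density y \<le> exp m * gauss_density c"
    and "gauss_density c \<le> exp m * gauss_density y"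
proof -
  have *: "gauss_density u \<le> exp m * gauss_density v" if "(norm v)\<^sup>2 - (norm u)\<^sup>2 \<le> m" for u v :: "real ^ 'n"
    using that gauss_density_pos[of v] by (subst gauss_density_eq_mult_exp[of u v]) simp
  show "gauss_density y \<le> exp m * gauss_density c" "gauss_density c \<le> exp m * gauss_density y"
    using assms abs_norm_sq_diff_le[of y c] by (intro *; linarith)+
qed

text \<open>In this product form the admissible radius needs no case distinction at the origin, and the
  openness in \<open>x\<close> of the condition \<open>t < adm x\<close> is evident.\<close>

lemma less_adm_iff: "t < adm x \<longleftrightarrow> t < 1 \<and> t * norm x < 1"
  by (auto simp: adm_def field_simps)

lemma le_adm_iff: "t \<le> adm x \<longleftrightarrow> t \<le> 1 \<and> t * norm x \<le> 1"
  by (auto simp: adm_def field_simps)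

lemma test_functionD:
  assumes "\<phi> \<in> test_functions"
  shows "norm (\<phi> u) \<le> 1" "\<phi> differentiable (at u)" "norm (partial_deriv i \<phi> u) \<le> 1"
    "1 \<le> norm u \<Longrightarrow> \<phi> u = 0"
proof -
  show "norm (\<phi> u) \<le> 1" "\<phi> differentiable (at u)" "norm (partial_deriv i \<phi> u) \<le> 1"
    using assms by (auto simp: test_functions_def C1_compact_support_def)
  have "{x. \<phi> x \<noteq> 0} \<subseteq> ball 0 1"
    using assms closure_subset[of "{x. \<phi> x \<noteq> 0}"]
    by (auto simp: test_functions_def C1_compact_support_def)
  then show "1 \<le> norm u \<Longrightarrow> \<phi> u = 0" by (auto simp: subset_iff)
qed

text \<open>The differential applied to \<open>h\<close> is \<open>\<Sum>\<^sub>i h\<^sub>i D\<^sub>i\<phi>\<close>, and each summand is at most \<open>|h|\<close>; the mean value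
  inequality gives the Lipschitz constant \<open>n\<close>.\<close>

lemma test_function_lipschitz:
  fixes \<phi> :: "real ^ 'n \<Rightarrow> complex"
  assumes "\<phi> \<in> test_functions"
  shows "norm (\<phi> u - \<phi> v) \<le> real CARD('n) * norm (u - v)"
proof (rule differentiable_bound[of UNIV \<phi> "\<lambda>x. frechet_derivative \<phi> (at x)"])
  show "(\<phi> has_derivative frechet_derivative \<phi> (at x)) (at x within UNIV)" for x
    using test_functionD(2)[OF assms] frechet_derivative_works by auto
  show "onorm (frechet_derivative \<phi> (at x)) \<le> real CARD('n)" for x
  proof (rule onorm_le)
    fix h :: "real ^ 'n"
    let ?D = "frechet_derivative \<phi> (at x)"
    have lin: "linear ?D"
      using test_functionD(2)[OF assms] linear_frechet_derivative by blast
    have "?D h = ?D (\<Sum>i\<in>UNIV. h $ i *\<^sub>R axis i 1)"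
      by (simp add: basis_expansion scalar_mult_eq_scaleR[symmetric])
    also have "\<dots> = (\<Sum>i\<in>UNIV. h $ i *\<^sub>R partial_deriv i \<phi> x)"
      by (simp add: linear_sum[OF lin] linear_scale[OF lin] partial_deriv_def)
    also have "norm \<dots> \<le> (\<Sum>i\<in>(UNIV::'n set). norm h * 1)"
      using test_functionD(3)[OF assms] component_le_norm_cart[of h]
      by (intro order_trans[OF norm_sum] sum_mono) (auto intro!: mult_mono simp del: mult_1_right)
    finally show "norm (?D h) \<le> real CARD('n) * norm h" by simp
  qed
qed auto

lemma test_function_measurable [measurable]:
  assumes "\<phi> \<in> test_functions"
  shows "\<phi> \<in> borel_measurable borel"
  using test_functionD(2)[OF assms]
  by (intro borel_measurable_continuous_onI)
     (auto intro: differentiable_imp_continuous_within simp: continuous_on_eq_continuous_within)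

lemma dilation_norm_le:
  fixes \<phi> :: "real ^ 'n \<Rightarrow> complex"
  assumes "\<phi> \<in> test_functions" "0 < t"
  shows "norm (dilation t \<phi> u) \<le> (1 / t ^ CARD('n)) * indicator (ball 0 t) u"
  using test_functionD(1,4)[OF assms(1), of "u /\<^sub>R t"] assms(2)
  by (auto simp: dilation_def indicator_def field_simps)

lemma dilation_lipschitz:
  fixes \<phi> :: "real ^ 'n \<Rightarrow> complex"
  assumes "\<phi> \<in> test_functions" "0 < t"
  shows "norm (dilation t \<phi> u - dilation t \<phi> v) \<le> real CARD('n) * norm (u - v) / t ^ Suc CARD('n)"
proof -
  have "norm (dilation t \<phi> u - dilation t \<phi> v) = norm (\<phi> (u /\<^sub>R t) - \<phi> (v /\<^sub>R t)) / t ^ CARD('n)"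
    using assms(2) by (simp add: dilation_def scaleR_diff_right[symmetric])
  also have "\<dots> \<le> (real CARD('n) * norm (u /\<^sub>R t - v /\<^sub>R t)) / t ^ CARD('n)"
    using test_function_lipschitz[OF assms(1)] assms(2) by (intro divide_right_mono) auto
  also have "norm (u /\<^sub>R t - v /\<^sub>R t) = norm (u - v) / t"
    using assms(2) by (simp add: scaleR_diff_right[symmetric] divide_inverse mult.commute)
  finally show ?thesis by simp
qed

lemma dilation_measurable [measurable]:
  assumes [measurable]: "\<phi> \<in> test_functions"
  shows "dilation t \<phi> \<in> borel_measurable borel"
proof -
  have [measurable]: "\<phi> \<in> borel_measurable borel" using assms by measurable
  show ?thesis unfolding dilation_def[abs_def] by measurable
qed

section \<open>Lebesgue convolution as an integral against the Gauss measure\<close>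

text \<open>Atoms have mean zero and functions are normed with respect to the Gauss measure, whereas the
  convolution is a Lebesgue integral. Dividing by the density turns the convolution into an
  integral operator on \<open>L\<^sup>1(\<gamma>)\<close> with this kernel. Test functions have compact support, so the
  kernel is bounded in \<open>y\<close> in spite of the unbounded factor \<open>1 / \<gamma>\<^sub>0(y)\<close>.\<close>

definition gauss_kernel ::
    "real \<Rightarrow> (real ^ 'n \<Rightarrow> complex) \<Rightarrow> real ^ 'n \<Rightarrow> real ^ 'n \<Rightarrow> complex" where
  "gauss_kernel t \<phi> x y = dilation t \<phi> (x - y) /\<^sub>R gauss_density y"

lemma gauss_kernel_measurable [measurable]:
  assumes "\<phi> \<in> test_functions"
  shows "gauss_kernel t \<phi> x \<in> borel_measurable borel"
proof -
  have [measurable]: "dilation t \<phi> \<in> borel_measurable borel" using assms by measurable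
  show ?thesis unfolding gauss_kernel_def[abs_def] by measurable
qed

lemma lebesgue_conv_eq_gauss_integral:
  assumes "\<phi> \<in> test_functions" and [measurable]: "f \<in> borel_measurable borel"
  shows "lebesgue_conv (dilation t \<phi>) f x = (\<integral>y. gauss_kernel t \<phi> x y * f y \<partial>gauss_measure)"
proof -
  have [measurable]: "gauss_kernel t \<phi> x \<in> borel_measurable borel" using assms by measurable
  have "(\<integral>y. gauss_kernel t \<phi> x y * f y \<partial>gauss_measure)
      = (\<integral>y. gauss_density y *\<^sub>R (gauss_kernel t \<phi> x y * f y) \<partial>lborel)"
    unfolding gauss_measure_def
    by (rule integral_density) (auto simp: less_imp_le[OF gauss_density_pos])
  also have "\<dots> = lebesgue_conv (dilation t \<phi>) f x"
    unfolding lebesgue_conv_def gauss_kernel_def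
    by (intro Bochner_Integration.integral_cong) (auto simp: less_imp_neq[OF gauss_density_pos, symmetric])
  finally show ?thesis by simp
qed

lemma inverse_gauss_density_le:
  fixes y :: "real ^ 'n"
  assumes "norm y \<le> R"
  shows "inverse (gauss_density y) \<le> pi powr (real CARD('n) / 2) * exp (R\<^sup>2)"
proof -
  have "(norm y)\<^sup>2 \<le> R\<^sup>2" using assms by (intro power_mono) auto
  then show ?thesis
    by (simp add: gauss_density_def exp_minus powr_minus)
qed

lemma gauss_kernel_norm_le:
  fixes x :: "real ^ 'n"
  assumes "\<phi> \<in> test_functions" "0 < t"
  shows "norm (gauss_kernel t \<phi> x y) \<le> (1 / t ^ CARD('n)) * (pi powr (real CARD('n) / 2) * exp ((norm x + t)\<^sup>2))"
proof (cases "norm (x - y) < t")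
  case True
  then have "norm y \<le> norm x + t"
    using norm_triangle_sub[of y x] by (simp add: norm_minus_commute)
  then show ?thesis
    using dilation_norm_le[OF assms, of "x - y"] True gauss_density_pos[of y] assms(2)
    unfolding gauss_kernel_def norm_scaleR
    by (subst mult.commute, intro mult_mono) (auto dest: inverse_gauss_density_le intro: order_trans)
next
  case False
  then have "dilation t \<phi> (x - y) = 0" using dilation_norm_le[OF assms, of "x - y"] by auto
  then show ?thesis using assms(2) by (simp add: gauss_kernel_def)
qed

lemma integrable_gauss_kernel_mult:
  assumes "\<phi> \<in> test_functions" "0 < t" "integrable gauss_measure f"
  shows "integrable gauss_measure (\<lambda>y. gauss_kernel t \<phi> x y * f y)"
proof -
  have [measurable]: "gauss_kernel t \<phi> x \<in> borel_measurable borel" using assms by measurable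
  have [measurable]: "f \<in> borel_measurable borel" using borel_measurable_integrable[OF assms(3)] by simp
  define K where "K = (1 / t ^ CARD('a)) * (pi powr (real CARD('a) / 2) * exp ((norm x + t)\<^sup>2))"
  have K: "norm (gauss_kernel t \<phi> x y) \<le> K" for y
    unfolding K_def using assms by (intro gauss_kernel_norm_le)
  show ?thesis
  proof (rule Bochner_Integration.integrable_bound)
    show "integrable gauss_measure (\<lambda>y. K * norm (f y))"
      using assms(3) by auto
    show "AE y in gauss_measure. norm (gauss_kernel t \<phi> x y * f y) \<le> norm (K * norm (f y))"
      using K order_trans[OF norm_ge_zero K]
      by (intro AE_I2) (auto simp: norm_mult abs_mult intro!: mult_right_mono)
  qed measurable
qed

lemma norm_integral_mult_le:
  fixes f k :: "'a \<Rightarrow> complex"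
  assumes "integrable M f" "0 \<le> K" "AE y in M. f y \<noteq> 0 \<longrightarrow> norm (k y) \<le> K"
  shows "norm (\<integral>y. k y * f y \<partial>M) \<le> K * (\<integral>y. norm (f y) \<partial>M)"
proof (cases "integrable M (\<lambda>y. k y * f y)")
  case True
  have "norm (\<integral>y. k y * f y \<partial>M) \<le> (\<integral>y. norm (k y * f y) \<partial>M)"
    by (rule integral_norm_bound)
  also have "\<dots> \<le> (\<integral>y. K * norm (f y) \<partial>M)"
  proof (rule integral_mono_AE)
    show "AE y in M. norm (k y * f y) \<le> K * norm (f y)"
      using assms(3) by eventually_elim (auto simp: norm_mult intro: mult_right_mono)
  qed (use True assms(1) in auto)
  finally show ?thesis by simp
next
  case False
  then show ?thesis using assms(2) by (simp add: not_integrable_integral_eq)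
qed

text \<open>For fixed \<open>\<phi>\<close>, \<open>t\<close>, \<open>x\<close> the convolution is a continuous functional on \<open>L\<^sup>1(\<gamma>)\<close>. The constant
  is far from uniform in \<open>x\<close> and \<open>t\<close>; it serves only to pass to the limit in an atomic series.\<close>

lemma norm_lebesgue_conv_le_L1:
  fixes f :: "real ^ 'n \<Rightarrow> complex"
  assumes "\<phi> \<in> test_functions" "0 < t" "integrable gauss_measure f"
  shows "norm (lebesgue_conv (dilation t \<phi>) f x)
    \<le> (1 / t ^ CARD('n)) * (pi powr (real CARD('n) / 2) * exp ((norm x + t)\<^sup>2)) * (\<integral>y. norm (f y) \<partial>gauss_measure)"
proof -
  have "f \<in> borel_measurable borel" using borel_measurable_integrable[OF assms(3)] by simp
  show ?thesis
    unfolding lebesgue_conv_eq_gauss_integral[OF assms(1) \<open>f \<in> borel_measurable borel\<close>]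
    using gauss_kernel_norm_le[OF assms(1,2), of x] assms(2)
    by (intro norm_integral_mult_le[OF assms(3)] AE_I2) auto
qed

lemma lebesgue_conv_diff:
  assumes "\<phi> \<in> test_functions" "0 < t" "integrable gauss_measure f" "integrable gauss_measure h"
  shows "lebesgue_conv (dilation t \<phi>) (\<lambda>y. f y - h y) x
    = lebesgue_conv (dilation t \<phi>) f x - lebesgue_conv (dilation t \<phi>) h x"
proof -
  have [measurable]: "f \<in> borel_measurable borel" "h \<in> borel_measurable borel"
    using assms(3,4)[THEN borel_measurable_integrable] by auto
  show ?thesis
    using assms by (simp add: lebesgue_conv_eq_gauss_integral right_diff_distrib integrable_gauss_kernel_mult)
qed

lemma lebesgue_conv_sum:
  assumes "\<phi> \<in> test_functions" "0 < t" "\<And>j. integrable gauss_measure (a j)"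
  shows "lebesgue_conv (dilation t \<phi>) (\<lambda>y. \<Sum>j<N. l j * a j y) x
    = (\<Sum>j<N. l j * lebesgue_conv (dilation t \<phi>) (a j) x)"
proof -
  have [measurable]: "a j \<in> borel_measurable borel" for j
    using assms(3)[THEN borel_measurable_integrable] by auto
  have "(\<integral>y. gauss_kernel t \<phi> x y * (\<Sum>j<N. l j * a j y) \<partial>gauss_measure)
      = (\<integral>y. (\<Sum>j<N. l j * (gauss_kernel t \<phi> x y * a j y)) \<partial>gauss_measure)"
    by (simp add: sum_distrib_left mult.left_commute)
  also have "\<dots> = (\<Sum>j<N. l j * (\<integral>y. gauss_kernel t \<phi> x y * a j y \<partial>gauss_measure))"
    using assms by (simp add: integrable_gauss_kernel_mult)
  finally show ?thesis
    using assms(1) by (simp add: lebesgue_conv_eq_gauss_integral)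
qed

section \<open>Measurability of the maximal function\<close>

text \<open>The kernels for two nearby points \<open>x\<close>, \<open>z\<close> both vanish for \<open>y\<close> outside one fixed ball, on which
  \<open>1 / \<gamma>\<^sub>0\<close> is bounded; there the Lipschitz bound for \<open>\<phi>\<^sub>t\<close> makes their difference of order
  \<open>|z - x|\<close>, uniformly in \<open>y\<close>.\<close>

lemma continuous_on_lebesgue_conv:
  fixes f :: "real ^ 'n \<Rightarrow> complex"
  assumes "\<phi> \<in> test_functions" "0 < t" "integrable gauss_measure f"
  shows "continuous_on UNIV (lebesgue_conv (dilation t \<phi>) f)"
proof -
  have [measurable]: "f \<in> borel_measurable borel" using borel_measurable_integrable[OF assms(3)] by simp
  note conv = lebesgue_conv_eq_gauss_integral[OF assms(1)]
  have "isCont (lebesgue_conv (dilation t \<phi>) f) x" for x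
  proof -
    define D where "D = pi powr (real CARD('n) / 2) * exp ((norm x + 1 + t)\<^sup>2)"
    define L where "L = real CARD('n) / t ^ Suc CARD('n) * D * (\<integral>y. norm (f y) \<partial>gauss_measure)"
    have "0 \<le> D" by (simp add: D_def)
    have ker: "norm (gauss_kernel t \<phi> z y - gauss_kernel t \<phi> x y)
        \<le> real CARD('n) * norm (z - x) / t ^ Suc CARD('n) * D" if "norm (z - x) < 1" for z y
    proof (cases "norm y \<le> norm x + 1 + t")
      case True
      have "norm (gauss_kernel t \<phi> z y - gauss_kernel t \<phi> x y)
          = norm (dilation t \<phi> (z - y) - dilation t \<phi> (x - y)) * inverse (gauss_density y)"
        using gauss_density_pos[of y]
        by (simp add: gauss_kernel_def scaleR_diff_right[symmetric] mult.commute)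
      also have "\<dots> \<le> real CARD('n) * norm (z - x) / t ^ Suc CARD('n) * D"
        using dilation_lipschitz[OF assms(1,2), of "z - y" "x - y"]
          inverse_gauss_density_le[OF True] assms(2) gauss_density_pos[of y]
        unfolding D_def by (intro mult_mono) auto
      finally show ?thesis .
    next
      case False
      have "norm y \<le> norm (z - y) + norm (z - x) + norm x" "norm y \<le> norm (x - y) + norm x"
        using norm_triangle_ineq4[of "z" "z - y"] norm_triangle_ineq[of "z - x" x]
          norm_triangle_ineq4[of "x" "x - y"] by auto
      then have "t \<le> norm (z - y)" "t \<le> norm (x - y)" using False that by auto
      then have "dilation t \<phi> (z - y) = 0" "dilation t \<phi> (x - y) = 0"
        using dilation_norm_le[OF assms(1,2), of "z - y"] dilation_norm_le[OF assms(1,2), of "x - y"]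
        by auto
      then show ?thesis using \<open>0 \<le> D\<close> assms(2) by (simp add: gauss_kernel_def)
    qed
    have bound: "norm (lebesgue_conv (dilation t \<phi>) f z - lebesgue_conv (dilation t \<phi>) f x)
        \<le> L * norm (z - x)" if "norm (z - x) < 1" for z
    proof -
      have "lebesgue_conv (dilation t \<phi>) f z - lebesgue_conv (dilation t \<phi>) f x
          = (\<integral>y. (gauss_kernel t \<phi> z y - gauss_kernel t \<phi> x y) * f y \<partial>gauss_measure)"
        using assms by (simp add: conv left_diff_distrib integrable_gauss_kernel_mult)
      also have "norm \<dots> \<le> real CARD('n) * norm (z - x) / t ^ Suc CARD('n) * D
          * (\<integral>y. norm (f y) \<partial>gauss_measure)"
        using ker[OF that] \<open>0 \<le> D\<close> assms(2)
        by (intro norm_integral_mult_le[OF assms(3)]) auto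
      finally show ?thesis by (simp add: L_def mult_ac)
    qed
    have "((\<lambda>z. lebesgue_conv (dilation t \<phi>) f z - lebesgue_conv (dilation t \<phi>) f x) \<longlongrightarrow> 0) (at x)"
    proof (rule Lim_null_comparison)
      show "\<forall>\<^sub>F z in at x. norm (lebesgue_conv (dilation t \<phi>) f z - lebesgue_conv (dilation t \<phi>) f x)
          \<le> L * norm (z - x)"
        unfolding eventually_at by (rule exI[of _ 1]) (auto simp: dist_norm intro: bound)
      show "((\<lambda>z. L * norm (z - x)) \<longlongrightarrow> 0) (at x)"
        by (intro tendsto_eq_intros) auto
    qed
    then show ?thesis by (simp add: isCont_def LIM_zero_iff)
  qed
  then show ?thesis by (simp add: continuous_at_imp_continuous_on)
qed

lemma M_loc_upper:
  assumes "\<phi> \<in> test_functions" "0 < t" "t < adm x"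
  shows "ennreal (norm (lebesgue_conv (dilation t \<phi>) f x)) \<le> M_loc f x"
  unfolding M_loc_def using assms by (intro Sup_upper) auto

lemma M_loc_least:
  assumes "\<And>\<phi> t. \<phi> \<in> test_functions \<Longrightarrow> 0 < t \<Longrightarrow> t < adm x \<Longrightarrow>
    ennreal (norm (lebesgue_conv (dilation t \<phi>) f x)) \<le> b"
  shows "M_loc f x \<le> b"
  unfolding M_loc_def using assms by (intro Sup_least) auto

text \<open>The supremum runs over an uncountable family, but the maximal function is lower
  semicontinuous: at a fixed \<open>(\<phi>, t)\<close> both the constraint on \<open>t\<close> and the inequality for the
  convolution are open conditions on \<open>x\<close>.\<close>

lemma borel_measurable_M_loc:
  fixes f :: "real ^ 'n \<Rightarrow> complex"
  assumes "integrable gauss_measure f"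
  shows "M_loc f \<in> borel_measurable borel"
proof (rule borel_measurableI_greater)
  fix b :: ennreal
  have "{x \<in> space borel. b < M_loc f x}
      = (\<Union>\<phi>\<in>test_functions. \<Union>t\<in>{0<..}.
          {x. t < 1 \<and> t * norm x < 1 \<and> b < ennreal (norm (lebesgue_conv (dilation t \<phi>) f x))})"
    by (auto simp: M_loc_def less_Sup_iff less_adm_iff)
  moreover have "open \<dots>"
    using continuous_on_lebesgue_conv[OF _ _ assms]
    by (intro open_UN ballI open_Collect_conj open_Collect_less continuous_intros
        continuous_on_ennreal) auto
  ultimately show "{x \<in> space borel. b < M_loc f x} \<in> sets borel" by simp
qed

section \<open>Two estimates with respect to Lebesgue measure\<close>

text \<open>The standard integral bound behind atomic estimates, by dyadic decomposition around \<open>c\<close>: where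
  \<open>2\<^sup>k r \<le> |x - c| < 2\<^sup>k\<^sup>+\<^sup>1 r\<close> the function is at most \<open>2\<^sup>-\<^sup>k K (2\<^sup>k r)\<^sup>-\<^sup>n\<close>, while the
  ball of radius \<open>2\<^sup>k\<^sup>+\<^sup>1 r\<close> has volume of order \<open>(2\<^sup>k r)\<^sup>n\<close>. What remains is a geometric series,
  and the bound does not depend on \<open>r\<close>.\<close>

lemma nn_integral_radial_tail_le:
  fixes F :: "'a::euclidean_space \<Rightarrow> ennreal"
  assumes r: "0 < r" and K: "0 \<le> K"
    and near: "\<And>x. norm (x - c) < 2 * r \<Longrightarrow> F x \<le> ennreal (K / r ^ DIM('a))"
    and far: "\<And>x. 2 * r \<le> norm (x - c) \<Longrightarrow> F x \<le> ennreal (K * r / norm (x - c) ^ Suc DIM('a))"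
  shows "(\<integral>\<^sup>+x. F x \<partial>lborel) \<le> ennreal (K * unit_ball_vol (real DIM('a)) * 2 ^ Suc DIM('a))"
proof -
  let ?n = "DIM('a)" and ?V = "unit_ball_vol (real DIM('a))"
  define w where "w k = K * (1 / 2) ^ k / (2 ^ k * r) ^ ?n" for k :: nat
  define G where "G k x = ennreal (w k) * indicator (cball c (2 ^ Suc k * r)) x" for k x
  have w_nonneg: "0 \<le> w k" for k using r K by (simp add: w_def)
  have le_suminf: "G k x \<le> (\<Sum>k. G k x)" for k x
    using sum_le_suminf[of "\<lambda>k. G k x" "{k}"] by simp
  have "F x \<le> (\<Sum>k. G k x)" for x
  proof (cases "norm (x - c) < 2 * r")
    case True
    then have "F x \<le> G 0 x"
      using near[OF True] by (simp add: G_def w_def dist_norm norm_minus_commute)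
    then show ?thesis using le_suminf order_trans by blast
  next
    case False
    define d where "d = norm (x - c)"
    \<comment> \<open>The minimal exponent with \<open>d < 2\<^sup>N r\<close> is positive because \<open>d \<ge> 2 r\<close>;
      its predecessor indexes the dyadic shell containing \<open>x\<close>.\<close>
    define N where "N = (LEAST n. d / r < 2 ^ n)"
    have N: "d / r < 2 ^ N"
      unfolding N_def by (rule LeastI_ex) (rule real_arch_pow, simp)
    moreover have "N \<noteq> 0"
      using N False r by (intro notI) (auto simp: d_def)
    ultimately obtain k where k: "N = Suc k" by (cases N) auto
    have "\<not> d / r < 2 ^ k"
      using not_less_Least[of k "\<lambda>n. d / r < 2 ^ n"] k by (auto simp: N_def)
    then have lo: "2 ^ k * r \<le> d" using r by (simp add: field_simps)
    have hi: "d \<le> 2 ^ Suc k * r" using N k r by (simp add: field_simps)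
    have "K * r / d ^ Suc ?n \<le> K * r / (2 ^ k * r) ^ Suc ?n"
      using lo r K by (intro divide_left_mono power_mono mult_pos_pos zero_less_power)
        (auto intro: less_le_trans[of 0 "2 ^ k * r"])
    also have "\<dots> = w k" using r by (simp add: w_def field_simps)
    finally have "ennreal (K * r / d ^ Suc ?n) \<le> ennreal (w k)" by (rule ennreal_leI)
    moreover have "F x \<le> ennreal (K * r / d ^ Suc ?n)" using far[of x] False by (simp add: d_def)
    moreover have "G k x = ennreal (w k)"
      using hi by (simp add: G_def d_def dist_norm norm_minus_commute)
    ultimately have "F x \<le> G k x" by simp
    then show ?thesis using le_suminf order_trans by blast
  qed
  then have "(\<integral>\<^sup>+x. F x \<partial>lborel) \<le> (\<integral>\<^sup>+x. (\<Sum>k. G k x) \<partial>lborel)"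
    by (intro nn_integral_mono) auto
  also have "\<dots> = (\<Sum>k. \<integral>\<^sup>+x. G k x \<partial>lborel)"
    unfolding G_def
    by (intro nn_integral_suminf borel_measurable_times_ennreal borel_measurable_const borel_measurable_indicator) auto
  also have "\<dots> = (\<Sum>k. ennreal (K * ?V * 2 ^ ?n * (1 / 2) ^ k))"
  proof (rule suminf_cong)
    fix k
    have "(\<integral>\<^sup>+x. G k x \<partial>lborel) = ennreal (w k) * ennreal (?V * (2 ^ Suc k * r) ^ ?n)"
      unfolding G_def using r by (simp add: nn_integral_cmult_indicator emeasure_cball)
    also have "\<dots> = ennreal (w k * (?V * (2 ^ Suc k * r) ^ ?n))"
      using w_nonneg by (simp add: ennreal_mult')
    also have "w k * (?V * (2 ^ Suc k * r) ^ ?n) = K * ?V * 2 ^ ?n * (1 / 2) ^ k"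
      using r by (simp add: w_def power_mult_distrib)
    finally show "(\<integral>\<^sup>+x. G k x \<partial>lborel) = ennreal (K * ?V * 2 ^ ?n * (1 / 2) ^ k)" .
  qed
  also have "\<dots> = ennreal (K * ?V * 2 ^ ?n * 2)"
    using sums_mult[OF geometric_sums[of "1 / 2 :: real"], of "K * ?V * 2 ^ ?n"] K
    by (intro suminf_ennreal_eq) auto
  finally show ?thesis by (simp add: mult_ac)
qed

text \<open>The function \<open>\<phi>\<^sub>t\<close> is at most \<open>t\<^sup>-\<^sup>n\<close> and lives on a ball of radius \<open>t\<close>, so its \<open>L\<^sup>1\<close> norm is
  at most the volume of the unit ball.\<close>

lemma norm_lebesgue_conv_le_sup:
  fixes f :: "real ^ 'n \<Rightarrow> complex"
  assumes "\<phi> \<in> test_functions" "0 < t" and [measurable]: "f \<in> borel_measurable borel"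
    and "0 \<le> A" and bound: "AE y in lborel. norm (f y) \<le> A"
  shows "norm (lebesgue_conv (dilation t \<phi>) f x) \<le> A * unit_ball_vol (real CARD('n))"
proof -
  let ?h = "\<lambda>y. A / t ^ CARD('n) * indicator (ball x t) y :: real"
  have [measurable]: "dilation t \<phi> \<in> borel_measurable borel" using assms(1) by measurable
  have "emeasure lborel (ball x t) < \<infinity>" using assms(2) by (simp add: emeasure_ball)
  then have int: "integrable lborel ?h" by (intro integrable_mult_right) auto
  have le: "AE y in lborel. norm (dilation t \<phi> (x - y) * f y) \<le> ?h y"
    using bound
  proof eventually_elim
    case (elim y)
    have "norm (dilation t \<phi> (x - y) * f y)
        \<le> (1 / t ^ CARD('n)) * indicator (ball 0 t) (x - y) * A"
      unfolding norm_mult using elim assms(2) dilation_norm_le[OF assms(1,2)] by (intro mult_mono) auto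
    then show ?case by (cases "norm (x - y) < t") (auto simp: dist_norm norm_mult norm_minus_commute)
  qed
  have int': "integrable lborel (\<lambda>y. dilation t \<phi> (x - y) * f y)"
  proof (rule Bochner_Integration.integrable_bound[OF int])
    show "AE y in lborel. norm (dilation t \<phi> (x - y) * f y) \<le> norm (?h y)"
      using le by eventually_elim (metis abs_ge_self order_trans real_norm_def)
  qed measurable
  have "norm (lebesgue_conv (dilation t \<phi>) f x) \<le> (\<integral>y. norm (dilation t \<phi> (x - y) * f y) \<partial>lborel)"
    unfolding lebesgue_conv_def by (rule integral_norm_bound)
  also have "\<dots> \<le> (\<integral>y. ?h y \<partial>lborel)"
    using int int' le by (intro integral_mono_AE) auto
  also have "\<dots> = A * unit_ball_vol (real CARD('n))"
    using assms(2) by (simp add: content_ball)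
  finally show ?thesis .
qed

section \<open>Pointwise decay of the maximal function of a cancelling atom\<close>

lemma abs_exp_minus_one_le: "\<bar>exp s - 1\<bar> \<le> \<bar>s\<bar> * exp \<bar>s\<bar>" for s :: real
proof (cases "0 \<le> s")
  case True
  have "(1 - s) * exp s \<le> exp (- s) * exp s"
    using exp_ge_add_one_self[of "- s"] by (intro mult_right_mono) auto
  then show ?thesis using True by (simp add: exp_minus algebra_simps)
next
  case False
  have "1 - exp s \<le> \<bar>s\<bar> * 1" using exp_ge_add_one_self[of s] False by linarith
  also have "\<dots> \<le> \<bar>s\<bar> * exp \<bar>s\<bar>" by (intro mult_left_mono) auto
  finally show ?thesis using False by simp
qed

text \<open>The smoothness estimate that pairs with the cancellation of an atom. Besides the usual variation
  of \<open>\<phi>\<^sub>t\<close>, of order \<open>r / t\<^sup>n\<^sup>+\<^sup>1\<close>, the kernel sees the variation of \<open>1 / \<gamma>\<^sub>0\<close> over the ball, of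
  relative order \<open>r (1 + |c|)\<close>. The second contribution is no worse than the first since
  \<open>t (1 + |c|)\<close> is bounded: \<open>t |x| < 1\<close> by the cut-off defining the local maximal function, and
  \<open>c\<close> lies within \<open>2 t\<close> of \<open>x\<close>. In the constant, \<open>3\<close> is a bound for \<open>r (2 |c| + r)\<close> and \<open>7\<close> one for
  \<open>t (2 |c| + r)\<close>.\<close>

lemma gauss_kernel_diff_le:
  fixes x c y :: "real ^ 'n"
  assumes "\<phi> \<in> test_functions" "0 < t" "t < adm x" "0 < r" "r \<le> adm c"
    and y: "norm (y - c) \<le> r" and x: "norm (x - c) < 2 * t"
  shows "norm (gauss_kernel t \<phi> x y - gauss_kernel t \<phi> x c)
    \<le> exp 3 * (real CARD('n) + 7) * r / t ^ Suc CARD('n) / gauss_density c"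
proof -
  let ?n = "CARD('n)"
  define s where "s = (norm y)\<^sup>2 - (norm c)\<^sup>2"
  have t: "t < 1" "t * norm x < 1" and r: "r \<le> 1" "r * norm c \<le> 1"
    using assms(3,5) by (auto simp: less_adm_iff le_adm_iff)
  have "\<bar>s\<bar> \<le> norm (y - c) * (2 * norm c + norm (y - c))"
    unfolding s_def by (rule abs_norm_sq_diff_le)
  also have "\<dots> \<le> r * (2 * norm c + r)"
    using y assms(4) by (intro mult_mono) auto
  finally have s_le: "\<bar>s\<bar> \<le> r * (2 * norm c + r)" .
  have "r * r \<le> 1" using r(1) assms(4) by (intro mult_le_one) auto
  then have s3: "\<bar>s\<bar> \<le> 3" using s_le r by (simp add: algebra_simps)
  have "t * norm c \<le> t * (norm x + norm (x - c))"
    using norm_triangle_ineq4[of x "x - c"] assms(2) by (intro mult_left_mono) auto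
  also have "\<dots> \<le> 1 + t * (2 * t)"
    using t mult_left_mono[OF less_imp_le[OF x], of t] assms(2) unfolding distrib_left by linarith
  also have "t * (2 * t) \<le> 1 * (2 * 1)" using t assms(2) by (intro mult_mono) auto
  finally have "t * norm c \<le> 3" by simp
  moreover have "t * r \<le> 1" using t r assms(2,4) by (intro mult_le_one) auto
  ultimately have "t * (2 * norm c + r) \<le> 7" by (simp add: algebra_simps)
  then have "r * (t * (2 * norm c + r)) \<le> r * 7" using assms(4) by (intro mult_left_mono) auto
  moreover have "t * \<bar>s\<bar> \<le> t * (r * (2 * norm c + r))" using s_le assms(2) by (intro mult_left_mono) auto
  ultimately have "t * \<bar>s\<bar> \<le> 7 * r" by (simp add: mult_ac)
  then have s_t: "\<bar>s\<bar> \<le> 7 * r / t" using assms(2) by (simp add: field_simps)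
  have inv: "inverse (gauss_density y) = inverse (gauss_density c) * exp s"
    using gauss_density_pos[of y] gauss_density_pos[of c] gauss_density_eq_mult_exp[of c y]
    by (simp add: s_def field_simps)
  have inv_le: "inverse (gauss_density y) \<le> inverse (gauss_density c) * exp 3"
    unfolding inv using s3 gauss_density_pos[of c] by (intro mult_left_mono) auto
  \<comment> \<open>The first summand carries the variation of \<open>\<phi>\<^sub>t\<close>, the second that of \<open>1 / \<gamma>\<^sub>0\<close>.\<close>
  have split: "gauss_kernel t \<phi> x y - gauss_kernel t \<phi> x c
      = inverse (gauss_density y) *\<^sub>R (dilation t \<phi> (x - y) - dilation t \<phi> (x - c))
        + (inverse (gauss_density c) * (exp s - 1)) *\<^sub>R dilation t \<phi> (x - c)"
    unfolding gauss_kernel_def inv by (simp add: algebra_simps)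
  have A: "norm (inverse (gauss_density y) *\<^sub>R (dilation t \<phi> (x - y) - dilation t \<phi> (x - c)))
      \<le> (inverse (gauss_density c) * exp 3) * (real ?n * r / t ^ Suc ?n)"
  proof -
    have "norm (dilation t \<phi> (x - y) - dilation t \<phi> (x - c)) \<le> real ?n * norm (y - c) / t ^ Suc ?n"
      using dilation_lipschitz[OF assms(1,2), of "x - y" "x - c"] by (simp add: norm_minus_commute)
    also have "\<dots> \<le> real ?n * r / t ^ Suc ?n"
      using y assms(2) by (intro divide_right_mono mult_left_mono) auto
    finally show ?thesis
      unfolding norm_scaleR using inv_le gauss_density_pos[of y] gauss_density_pos[of c]
      by (intro mult_mono) auto
  qed
  have B: "norm ((inverse (gauss_density c) * (exp s - 1)) *\<^sub>R dilation t \<phi> (x - c))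
      \<le> (inverse (gauss_density c) * (7 * r / t * exp 3)) * (1 / t ^ ?n)"
  proof -
    have "\<bar>exp s - 1\<bar> \<le> \<bar>s\<bar> * exp \<bar>s\<bar>" by (rule abs_exp_minus_one_le)
    also have "\<dots> \<le> 7 * r / t * exp 3"
      using s_t s3 assms(2,4) by (intro mult_mono) auto
    finally have e: "\<bar>exp s - 1\<bar> \<le> 7 * r / t * exp 3" .
    have "norm (dilation t \<phi> (x - c)) \<le> (1 / t ^ ?n) * indicator (ball 0 t) (x - c)"
      by (rule dilation_norm_le[OF assms(1,2)])
    also have "\<dots> \<le> 1 / t ^ ?n" using assms(2) by (auto simp: indicator_def)
    finally show ?thesis
      unfolding norm_scaleR abs_mult using e gauss_density_pos[of c] assms(2,4)
      by (intro mult_mono) auto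
  qed
  have "norm (gauss_kernel t \<phi> x y - gauss_kernel t \<phi> x c)
      \<le> (inverse (gauss_density c) * exp 3) * (real ?n * r / t ^ Suc ?n)
        + (inverse (gauss_density c) * (7 * r / t * exp 3)) * (1 / t ^ ?n)"
    unfolding split using A B by (intro norm_triangle_le add_mono)
  also have "\<dots> = exp 3 * (real ?n + 7) * r / t ^ Suc ?n / gauss_density c"
    using assms(2) gauss_density_pos[of c] by (simp add: field_simps)
  finally show ?thesis .
qed

text \<open>Far from the ball there are two cases. If \<open>t\<close> is at most half the distance \<open>d\<close> from \<open>x\<close> to \<open>c\<close>, the
  support of the kernel misses the ball, which has radius at most \<open>d / 2\<close>. Otherwise the mean value
  zero allows the kernel to be replaced by its increment from the centre, and \<open>t > d / 2\<close> turns the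
  bound \<open>r / t\<^sup>n\<^sup>+\<^sup>1\<close> on the increment into decay in \<open>d\<close>.\<close>

lemma lebesgue_conv_cancelling_bounds:
  fixes a :: "real ^ 'n \<Rightarrow> complex" and x c :: "real ^ 'n"
  assumes "\<phi> \<in> test_functions" "0 < t" "t < adm x" "0 < r" "r \<le> adm c"
    and int: "integrable gauss_measure a"
    and supp: "AE y in gauss_measure. y \<notin> cball c r \<longrightarrow> a y = 0"
    and mean: "(\<integral>y. a y \<partial>gauss_measure) = 0"
    and L1: "(\<integral>y. norm (a y) \<partial>gauss_measure) \<le> 1"
    and far: "2 * r \<le> norm (x - c)"
  shows "2 * t \<le> norm (x - c) \<Longrightarrow> lebesgue_conv (dilation t \<phi>) a x = 0" (is "_ \<Longrightarrow> ?conv = 0")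
    and "norm (x - c) < 2 * t \<Longrightarrow> norm (lebesgue_conv (dilation t \<phi>) a x)
      \<le> exp 3 * (real CARD('n) + 7) * 2 ^ Suc CARD('n) * r / norm (x - c) ^ Suc CARD('n) / gauss_density c"
proof -
  let ?n = "CARD('n)"
  define d where "d = norm (x - c)"
  have [measurable]: "a \<in> borel_measurable borel" using borel_measurable_integrable[OF int] by simp
  note conv = lebesgue_conv_eq_gauss_integral[OF assms(1) \<open>a \<in> borel_measurable borel\<close>]
  {
    assume "2 * t \<le> norm (x - c)"
    have "gauss_kernel t \<phi> x y = 0" if "y \<in> cball c r" for y
    proof -
      have "norm (x - c) \<le> norm (x - y) + norm (y - c)"
        using norm_triangle_ineq[of "x - y" "y - c"] by simp
      then have "t \<le> norm (x - y)"
        using that \<open>2 * t \<le> _\<close> far by (auto simp: dist_norm norm_minus_commute)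
      then have "dilation t \<phi> (x - y) = 0"
        using dilation_norm_le[OF assms(1,2), of "x - y"] by auto
      then show ?thesis by (simp add: gauss_kernel_def)
    qed
    then have "AE y in gauss_measure. a y \<noteq> 0 \<longrightarrow> norm (gauss_kernel t \<phi> x y) \<le> 0"
      using supp by (auto elim!: eventually_mono)
    then show "?conv = 0"
      using norm_integral_mult_le[OF int, of 0 "gauss_kernel t \<phi> x"] by (simp add: conv)
  }
  assume close: "norm (x - c) < 2 * t"
  define K where "K = exp 3 * (real ?n + 7) * r / t ^ Suc ?n / gauss_density c"
  have "0 \<le> K" using assms(2,4) gauss_density_pos[of c] by (simp add: K_def)
  have "?conv = (\<integral>y. gauss_kernel t \<phi> x y * a y \<partial>gauss_measure)
      - gauss_kernel t \<phi> x c * (\<integral>y. a y \<partial>gauss_measure)"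
    by (simp add: conv mean)
  also have "\<dots> = (\<integral>y. (gauss_kernel t \<phi> x y - gauss_kernel t \<phi> x c) * a y \<partial>gauss_measure)"
    using int integrable_gauss_kernel_mult[OF assms(1,2) int] by (simp add: left_diff_distrib)
  also have "norm \<dots> \<le> K * (\<integral>y. norm (a y) \<partial>gauss_measure)"
  proof (rule norm_integral_mult_le[OF int \<open>0 \<le> K\<close>])
    show "AE y in gauss_measure. a y \<noteq> 0 \<longrightarrow> norm (gauss_kernel t \<phi> x y - gauss_kernel t \<phi> x c) \<le> K"
      using supp
    proof eventually_elim
      case (elim y)
      then show ?case
        using gauss_kernel_diff_le[OF assms(1-5) _ close, of y]
        by (auto simp: K_def dist_norm norm_minus_commute)
    qed
  qed
  also have "\<dots> \<le> K * 1" using L1 \<open>0 \<le> K\<close> by (intro mult_left_mono)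
  also have "\<dots> \<le> exp 3 * (real ?n + 7) * r / (d / 2) ^ Suc ?n / gauss_density c"
    unfolding K_def mult_1_right
    using close far assms(2,4) gauss_density_pos[of c]
    by (intro divide_right_mono divide_left_mono power_mono mult_pos_pos zero_less_power) (auto simp: d_def)
  also have "\<dots> = exp 3 * (real ?n + 7) * 2 ^ Suc ?n * r / d ^ Suc ?n / gauss_density c"
    by (simp add: power_divide field_simps)
  finally show "norm ?conv
      \<le> exp 3 * (real ?n + 7) * 2 ^ Suc ?n * r / norm (x - c) ^ Suc ?n / gauss_density c"
    by (simp add: d_def)
qed

section \<open>Uniform bound on atoms\<close>

lemma measure_gauss_admissible_ball_ge:
  fixes c :: "real ^ 'n"
  assumes "0 < r" "r \<le> adm c"
  shows "gauss_density c * unit_ball_vol (real CARD('n)) * r ^ CARD('n) / exp 3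
    \<le> measure gauss_measure (cball c r)"
proof -
  interpret prob_space "gauss_measure :: (real ^ 'n) measure" by (rule prob_space_gauss_measure)
  let ?m = "gauss_density c / exp 3"
  have r: "r \<le> 1" "r * norm c \<le> 1" using assms(2) by (auto simp: le_adm_iff)
  have "?m \<le> gauss_density y" if "y \<in> cball c r" for y
  proof -
    have yc: "norm (y - c) \<le> r" using that by (simp add: dist_norm norm_minus_commute)
    have "norm (y - c) * (2 * norm c + norm (y - c)) \<le> r * (2 * norm c + r)"
      using yc assms(1) by (intro mult_mono) auto
    also have "\<dots> \<le> 3" using r assms(1) mult_le_one[of r r] by (simp add: algebra_simps)
    finally show ?thesis
      using gauss_density_comparable(2)[of y c 3] by (simp add: field_simps)
  qed
  then have "(\<integral>\<^sup>+y. ennreal ?m * indicator (cball c r) y \<partial>lborel)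
      \<le> (\<integral>\<^sup>+y. ennreal (gauss_density y) * indicator (cball c r) y \<partial>lborel)"
    by (intro nn_integral_mono) (auto simp: indicator_def intro: ennreal_leI)
  also have "\<dots> = ennreal (measure gauss_measure (cball c r))"
    by (simp add: emeasure_eq_measure[symmetric]) (simp add: gauss_measure_def emeasure_density)
  also have "(\<integral>\<^sup>+y. ennreal ?m * indicator (cball c r) y \<partial>lborel)
      = ennreal (gauss_density c * unit_ball_vol (real CARD('n)) * r ^ CARD('n) / exp 3)"
    using assms(1) gauss_density_pos[of c]
    by (subst nn_integral_cmult_indicator) (simp_all add: emeasure_cball ennreal_mult'[symmetric] mult_ac)
  finally show ?thesis by (simp add: measure_nonneg)
qed

text \<open>The conditions on an atom in the form used below: the size condition becomes a Lebesgue almost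
  everywhere bound in terms of \<open>\<gamma>\<^sub>0(c) r\<^sup>n\<close>, to which the Gauss measure of an admissible ball is
  comparable, and an \<open>L\<^sup>1(\<gamma>)\<close> bound.\<close>

lemma gauss_atom_cases:
  fixes a :: "real ^ 'n \<Rightarrow> complex"
  assumes "gauss_atom a"
  obtains (const) "a = (\<lambda>_. 1)"
  | (ball) c r where "0 < r" "r \<le> adm c" "integrable gauss_measure a"
      "AE y in gauss_measure. y \<notin> cball c r \<longrightarrow> a y = 0"
      "(\<integral>y. a y \<partial>gauss_measure) = 0" "(\<integral>y. norm (a y) \<partial>gauss_measure) \<le> 1"
      "AE y in lborel. norm (a y) \<le> exp 3 / (gauss_density c * unit_ball_vol (real CARD('n)) * r ^ CARD('n))"
proof -
  interpret prob_space "gauss_measure :: (real ^ 'n) measure" by (rule prob_space_gauss_measure)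
  consider "a = (\<lambda>_. 1)" | B where "admissible_ball B" "a \<in> borel_measurable gauss_measure"
      "AE x in gauss_measure. x \<notin> B \<longrightarrow> a x = 0" "(\<integral>x. a x \<partial>gauss_measure) = 0"
      "esssup gauss_measure (\<lambda>x. ereal (norm (a x))) \<le> ereal (1 / measure gauss_measure B)"
    using assms unfolding gauss_atom_def by blast
  then show ?thesis
  proof cases
    case 1
    then show ?thesis by (rule const)
  next
    case (2 B)
    then obtain c r where cr: "0 < r" "r \<le> adm c" and B: "B = cball c r"
      by (auto simp: admissible_ball_def)
    have [measurable]: "a \<in> borel_measurable borel" using 2 by simp
    let ?lb = "gauss_density c * unit_ball_vol (real CARD('n)) * r ^ CARD('n) / exp 3"
    have "0 < ?lb" using gauss_density_pos[of c] cr by simp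
    moreover have "?lb \<le> measure gauss_measure B"
      unfolding B by (rule measure_gauss_admissible_ball_ge[OF cr])
    ultimately have pos: "0 < measure gauss_measure B"
      and inv_le: "1 / measure gauss_measure B \<le> 1 / ?lb"
      by (linarith, intro divide_left_mono mult_pos_pos) auto
    have ae: "AE y in gauss_measure. norm (a y) \<le> 1 / measure gauss_measure B"
      using esssup_AE[of "\<lambda>x. ereal (norm (a x))" gauss_measure]
    proof eventually_elim
      case (elim y)
      then show ?case using 2(5) order_trans by fastforce
    qed
    have int: "integrable gauss_measure a"
      using ae by (intro integrable_const_bound) auto
    have le: "AE y in gauss_measure. norm (a y) \<le> 1 / measure gauss_measure B * indicator B y"
      using ae 2(3) by eventually_elim (auto simp: indicator_def)
    have "(\<integral>y. norm (a y) \<partial>gauss_measure) \<le> (\<integral>y. 1 / measure gauss_measure B * indicator B y \<partial>gauss_measure)"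
      using le int by (intro integral_mono_AE) (auto simp: B intro!: integrable_real_indicator emeasure_finite simp: less_top[symmetric])
    also have "\<dots> = 1" using pos by (simp add: B)
    finally have L1: "(\<integral>y. norm (a y) \<partial>gauss_measure) \<le> 1" .
    have "AE y in lborel. norm (a y) \<le> 1 / measure gauss_measure B"
      using ae unfolding gauss_measure_def by (subst (asm) AE_density) (auto simp: gauss_density_pos)
    then have "AE y in lborel. norm (a y) \<le> 1 / ?lb"
      using inv_le by (auto elim!: eventually_mono)
    then show ?thesis
      using ball[OF cr int _ 2(4) L1] 2(3) by (simp add: B)
  qed
qed

lemma gauss_atom_integrable:
  assumes "gauss_atom a"
  shows "integrable gauss_measure a"
proof -
  interpret prob_space "gauss_measure :: (real ^ 'a) measure" by (rule prob_space_gauss_measure)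
  show ?thesis using assms by (cases rule: gauss_atom_cases) auto
qed

lemma nn_integral_M_loc_constant_le:
  "(\<integral>\<^sup>+x. M_loc (\<lambda>_::real ^ 'n. 1) x \<partial>gauss_measure) \<le> ennreal (unit_ball_vol (real CARD('n)))"
proof -
  have "M_loc (\<lambda>_. 1) x \<le> ennreal (unit_ball_vol (real CARD('n)))" for x :: "real ^ 'n"
    using norm_lebesgue_conv_le_sup[where f = "\<lambda>_. 1" and A = 1]
    by (intro M_loc_least ennreal_leI) auto
  then have "(\<integral>\<^sup>+x. M_loc (\<lambda>_::real ^ 'n. 1) x \<partial>gauss_measure)
      \<le> (\<integral>\<^sup>+x. ennreal (unit_ball_vol (real CARD('n))) \<partial>(gauss_measure :: (real ^ 'n) measure))"
    by (intro nn_integral_mono) auto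
  then show ?thesis by (simp add: emeasure_gauss_measure_UNIV)
qed

text \<open>After multiplication by the density the maximal function satisfies the hypotheses of
  \<open>nn_integral_radial_tail_le\<close> with a constant independent of the ball. Near the ball, at distance less
  than \<open>2 r\<close> from \<open>c\<close>, the size of the atom suffices. At distance \<open>d \<ge> 2 r\<close> the decay estimate has the
  factor \<open>1 / \<gamma>\<^sub>0(c)\<close>, which the density at \<open>x\<close> compensates as long as \<open>d\<close> is below \<open>2 adm x\<close>;
  for larger \<open>d\<close> no admissible \<open>t\<close> exceeds \<open>d / 2\<close> and the maximal function vanishes.\<close>

lemma nn_integral_M_loc_cancelling_le:
  fixes a :: "real ^ 'n \<Rightarrow> complex"
  assumes "0 < r" "r \<le> adm c"
    and int: "integrable gauss_measure a"
    and supp: "AE y in gauss_measure. y \<notin> cball c r \<longrightarrow> a y = 0"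
    and mean: "(\<integral>y. a y \<partial>gauss_measure) = 0"
    and L1: "(\<integral>y. norm (a y) \<partial>gauss_measure) \<le> 1"
    and sup: "AE y in lborel. norm (a y) \<le> exp 3 / (gauss_density c * unit_ball_vol (real CARD('n)) * r ^ CARD('n))"
  shows "(\<integral>\<^sup>+x. M_loc a x \<partial>gauss_measure)
    \<le> ennreal (exp 19 * (real CARD('n) + 7) * 2 ^ Suc CARD('n) * unit_ball_vol (real CARD('n)) * 2 ^ Suc CARD('n))"
proof -
  let ?n = "CARD('n)" and ?V = "unit_ball_vol (real CARD('n))"
  \<comment> \<open>Far from the ball, \<open>exp 19\<close> is \<open>exp 3\<close> from the decay estimate times \<open>exp 16\<close> from comparing
    the densities at \<open>x\<close> and \<open>c\<close>; near the ball the smaller \<open>exp 11\<close> would do.\<close>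
  define K where "K = exp 19 * (real ?n + 7) * 2 ^ Suc ?n"
  have [measurable]: "a \<in> borel_measurable borel" using borel_measurable_integrable[OF int] by simp
  have [measurable]: "M_loc a \<in> borel_measurable borel" by (rule borel_measurable_M_loc[OF int])
  have r: "r \<le> 1" "r * norm c \<le> 1" using assms(2) by (auto simp: le_adm_iff)
  have gc: "0 < gauss_density c" by (rule gauss_density_pos)
  have V: "0 < ?V" by simp
  have "(\<integral>\<^sup>+x. M_loc a x \<partial>gauss_measure) = (\<integral>\<^sup>+x. ennreal (gauss_density x) * M_loc a x \<partial>lborel)"
    unfolding gauss_measure_def by (rule nn_integral_density) auto
  also have "\<dots> \<le> ennreal (K * unit_ball_vol (real DIM(real ^ 'n)) * 2 ^ Suc DIM(real ^ 'n))"
  proof (rule nn_integral_radial_tail_le[OF assms(1)])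
    show "0 \<le> K" by (simp add: K_def)
  next
    fix x assume x: "norm (x - c) < 2 * r"
    let ?A = "exp 3 / (gauss_density c * ?V * r ^ ?n)"
    have "M_loc a x \<le> ennreal (?A * ?V)"
      using gc assms(1) by (intro M_loc_least ennreal_leI norm_lebesgue_conv_le_sup sup) auto
    moreover have "gauss_density x \<le> exp 8 * gauss_density c"
    proof (rule gauss_density_comparable(1))
      have "norm (x - c) * (2 * norm c + norm (x - c)) \<le> (2 * r) * (2 * norm c + 2 * r)"
        using x assms(1) by (intro mult_mono) auto
      also have "\<dots> \<le> 8" using r assms(1) mult_le_one[of r r] by (simp add: algebra_simps)
      finally show "norm (x - c) * (2 * norm c + norm (x - c)) \<le> 8" .
    qed
    ultimately have "ennreal (gauss_density x) * M_loc a x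
        \<le> ennreal (exp 8 * gauss_density c) * ennreal (?A * ?V)"
      by (intro mult_mono ennreal_leI) auto
    also have "\<dots> = ennreal ((exp 8 * gauss_density c) * (?A * ?V))"
      using gc assms(1) by (intro ennreal_mult[symmetric]) auto
    also have "(exp 8 * gauss_density c) * (?A * ?V) = exp 11 / r ^ ?n"
      using gc assms(1) exp_add[of 8 "3::real"] by (simp add: field_simps less_imp_neq[OF V, symmetric])
    also have "\<dots> \<le> K / r ^ ?n"
    proof (intro divide_right_mono)
      have "exp 11 * (1 * 1) \<le> exp 19 * ((real ?n + 7) * 2 ^ Suc ?n)"
        by (intro mult_mono one_le_power) auto
      then show "exp 11 \<le> K" by (simp add: K_def mult_ac)
    qed (use assms(1) in auto)
    finally show "ennreal (gauss_density x) * M_loc a x \<le> ennreal (K / r ^ DIM(real ^ 'n))"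
      by (simp add: ennreal_leI)
  next
    fix x assume far: "2 * r \<le> norm (x - c)"
    define d where "d = norm (x - c)"
    have "0 < d" using far assms(1) unfolding d_def by linarith
    let ?b = "exp 3 * (real ?n + 7) * 2 ^ Suc ?n * r / d ^ Suc ?n / gauss_density c"
    note bounds = lebesgue_conv_cancelling_bounds[OF _ _ _ assms(1,2) int supp mean L1 far]
    have "0 \<le> ?b" using assms(1) gc \<open>0 < d\<close> by simp
    have "M_loc a x \<le> ennreal ?b"
    proof (rule M_loc_least)
      fix \<phi> :: "real ^ 'n \<Rightarrow> complex" and t
      assume "\<phi> \<in> test_functions" "0 < t" "t < adm x"
      note b = bounds[OF this]
      show "ennreal (norm (lebesgue_conv (dilation t \<phi>) a x)) \<le> ennreal ?b"
      proof (cases "2 * t \<le> d")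
        case True
        then show ?thesis using b(1) \<open>0 \<le> ?b\<close> by (simp add: d_def)
      next
        case False
        then show ?thesis using b(2) by (intro ennreal_leI) (simp add: d_def)
      qed
    qed
    have "ennreal (gauss_density x) * M_loc a x \<le> ennreal (exp 16 * gauss_density c) * ennreal ?b"
    proof (cases "d < 2 * adm x")
      case True
      have small: "d \<le> 2" "d * norm x \<le> 2"
        using True less_adm_iff[of "d / 2" x] by auto
      \<comment> \<open>Admissibility is known at \<open>x\<close> and has to be transported to \<open>c\<close>.\<close>
      have "d * norm c \<le> d * (norm x + d)"
        using norm_triangle_ineq4[of x "x - c"] \<open>0 < d\<close> by (intro mult_left_mono) (auto simp: d_def)
      moreover have "d * d \<le> 2 * 2" using small \<open>0 < d\<close> by (intro mult_mono) auto
      ultimately have "d * (2 * norm c + d) \<le> 16" using small by (simp add: algebra_simps)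
      then have "gauss_density x \<le> exp 16 * gauss_density c"
        unfolding d_def by (rule gauss_density_comparable(1))
      then show ?thesis using \<open>M_loc a x \<le> _\<close> by (intro mult_mono ennreal_leI) auto
    next
      case False
      have "M_loc a x \<le> 0"
        using False bounds(1) by (intro M_loc_least) (auto simp: d_def)
      then show ?thesis by simp
    qed
    also have "\<dots> = ennreal ((exp 16 * gauss_density c) * ?b)"
      using \<open>0 \<le> ?b\<close> gc by (intro ennreal_mult[symmetric]) auto
    also have "(exp 16 * gauss_density c) * ?b = K * r / d ^ Suc ?n"
      using gc \<open>0 < d\<close> exp_add[of 16 "3::real"] by (simp add: K_def field_simps)
    finally show "ennreal (gauss_density x) * M_loc a x
        \<le> ennreal (K * r / norm (x - c) ^ Suc DIM(real ^ 'n))"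
      by (simp add: d_def)
  qed
  finally show ?thesis by (simp add: K_def)
qed

lemma nn_integral_M_loc_atom_bounded:
  "\<exists>C>0. \<forall>a :: real ^ 'n \<Rightarrow> complex. gauss_atom a \<longrightarrow>
     (\<integral>\<^sup>+x. M_loc a x \<partial>gauss_measure) \<le> ennreal C"
proof -
  let ?V = "unit_ball_vol (real CARD('n))"
  let ?C = "exp 19 * (real CARD('n) + 7) * 2 ^ Suc CARD('n) * ?V * 2 ^ Suc CARD('n)"
  have "(\<integral>\<^sup>+x. M_loc a x \<partial>gauss_measure) \<le> ennreal (?V + ?C)" if "gauss_atom a" for a :: "real ^ 'n \<Rightarrow> complex"
    using that
  proof (cases rule: gauss_atom_cases)
    case const
    then show ?thesis
      using nn_integral_M_loc_constant_le by (auto elim!: order_trans intro!: ennreal_leI)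
  next
    case (ball c r)
    show ?thesis
      by (rule order_trans[OF nn_integral_M_loc_cancelling_le[OF ball]]) (auto intro!: ennreal_leI)
  qed
  moreover have "0 < ?V + ?C" by (intro add_pos_nonneg) auto
  ultimately show ?thesis by blast
qed

section \<open>Summation over an atomic decomposition\<close>

text \<open>Since each single convolution is continuous on \<open>L\<^sup>1(\<gamma>)\<close>, it can be evaluated termwise along a series
  converging in that norm; only afterwards is the supremum over \<open>\<phi>\<close> and \<open>t\<close> taken.\<close>

lemma M_loc_countably_subadditive:
  fixes f :: "real ^ 'n \<Rightarrow> complex"
  assumes f: "integrable gauss_measure f" and a: "\<And>j. integrable gauss_measure (a j)"
    and lim: "(\<lambda>N. \<integral>x. norm (f x - (\<Sum>j<N. l j * a j x)) \<partial>gauss_measure) \<longlonglongrightarrow> 0"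
  shows "M_loc f x \<le> (\<Sum>j. ennreal (norm (l j)) * M_loc (a j) x)"
proof (rule M_loc_least)
  fix \<phi> :: "real ^ 'n \<Rightarrow> complex" and t
  assume \<phi>: "\<phi> \<in> test_functions" "0 < t" "t < adm x"
  let ?conv = "\<lambda>h. lebesgue_conv (dilation t \<phi>) h x"
  let ?S = "\<lambda>N y. \<Sum>j<N. l j * a j y"
  define K where "K = (1 / t ^ CARD('n)) * (pi powr (real CARD('n) / 2) * exp ((norm x + t)\<^sup>2))"
  have S: "integrable gauss_measure (?S N)" for N using a by auto
  have "(\<lambda>N. ?conv f - ?conv (?S N)) \<longlonglongrightarrow> 0"
  proof (rule Lim_null_comparison)
    show "\<forall>\<^sub>F N in sequentially. norm (?conv f - ?conv (?S N))
        \<le> K * (\<integral>y. norm (f y - ?S N y) \<partial>gauss_measure)"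
      using norm_lebesgue_conv_le_L1[OF \<phi>(1,2) Bochner_Integration.integrable_diff[OF f S]]
      by (simp add: lebesgue_conv_diff[OF \<phi>(1,2) f S] K_def)
    show "(\<lambda>N. K * (\<integral>y. norm (f y - ?S N y) \<partial>gauss_measure)) \<longlonglongrightarrow> 0"
      using tendsto_mult_left[OF lim, of K] by simp
  qed
  from tendsto_diff[OF tendsto_const[of "?conv f"] this]
  have "(\<lambda>N. ennreal (norm (?conv (?S N)))) \<longlonglongrightarrow> ennreal (norm (?conv f))"
    by (intro tendsto_ennrealI tendsto_norm) simp
  then show "ennreal (norm (?conv f)) \<le> (\<Sum>j. ennreal (norm (l j)) * M_loc (a j) x)"
  proof (rule tendsto_upperbound)
    show "\<forall>\<^sub>F N in sequentially. ennreal (norm (?conv (?S N))) \<le> (\<Sum>j. ennreal (norm (l j)) * M_loc (a j) x)"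
    proof (rule always_eventually, rule allI)
      fix N
      have "ennreal (norm (?conv (?S N))) \<le> ennreal (\<Sum>j<N. norm (l j) * norm (?conv (a j)))"
        unfolding lebesgue_conv_sum[OF \<phi>(1,2) a]
        by (intro ennreal_leI order_trans[OF norm_sum]) (simp add: norm_mult)
      also have "\<dots> = (\<Sum>j<N. ennreal (norm (l j)) * ennreal (norm (?conv (a j))))"
        by (simp add: sum_ennreal[symmetric] ennreal_mult del: sum_ennreal)
      also have "\<dots> \<le> (\<Sum>j<N. ennreal (norm (l j)) * M_loc (a j) x)"
        by (intro sum_mono mult_left_mono M_loc_upper[OF \<phi>]) auto
      also have "\<dots> \<le> (\<Sum>j. ennreal (norm (l j)) * M_loc (a j) x)"
        by (intro sum_le_suminf) auto
      finally show "ennreal (norm (?conv (?S N))) \<le> (\<Sum>j. ennreal (norm (l j)) * M_loc (a j) x)" .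
    qed
  qed simp
qed

lemma nn_integral_M_loc_le_of_atomic_rep:
  fixes f :: "real ^ 'n \<Rightarrow> complex"
  assumes "integrable gauss_measure f" and rep: "atomic_rep f l a" and "0 \<le> C"
    and C: "\<And>a :: real ^ 'n \<Rightarrow> complex. gauss_atom a \<Longrightarrow> (\<integral>\<^sup>+x. M_loc a x \<partial>gauss_measure) \<le> ennreal C"
  shows "(\<integral>\<^sup>+x. M_loc f x \<partial>gauss_measure) \<le> ennreal (C * (\<Sum>j. norm (l j)))"
proof -
  have atoms: "gauss_atom (a j)" for j using rep by (simp add: atomic_rep_def)
  have l: "summable (\<lambda>j. norm (l j))" using rep by (simp add: atomic_rep_def)
  note int = gauss_atom_integrable[OF atoms]
  have [measurable]: "M_loc (a j) \<in> borel_measurable borel" for j by (rule borel_measurable_M_loc[OF int])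
  have "(\<integral>\<^sup>+x. M_loc f x \<partial>gauss_measure)
      \<le> (\<integral>\<^sup>+x. (\<Sum>j. ennreal (norm (l j)) * M_loc (a j) x) \<partial>gauss_measure)"
    using rep by (intro nn_integral_mono M_loc_countably_subadditive assms(1) int) (simp add: atomic_rep_def)
  also have "\<dots> = (\<Sum>j. ennreal (norm (l j)) * (\<integral>\<^sup>+x. M_loc (a j) x \<partial>gauss_measure))"
    by (simp add: nn_integral_suminf nn_integral_cmult)
  also have "\<dots> \<le> (\<Sum>j. ennreal (C * norm (l j)))"
    using C[OF atoms] \<open>0 \<le> C\<close>
    by (intro suminf_le) (auto simp: ennreal_mult mult.commute[of "ennreal C"] intro!: mult_left_mono)
  also have "\<dots> = ennreal (C * (\<Sum>j. norm (l j)))"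
    using \<open>0 \<le> C\<close> sums_mult[OF summable_sums[OF l], of C] by (intro suminf_ennreal_eq) auto
  finally show ?thesis .
qed

theorem lemma3p2:
  "\<exists>C::real. \<forall>f \<in> (H1_gauss :: (real ^ 'n \<Rightarrow> complex) set).
     M_loc f \<in> borel_measurable gauss_measure \<and>
     (\<integral>\<^sup>+ x. M_loc f x \<partial>gauss_measure) < \<infinity> \<and>
     (\<integral>\<^sup>+ x. M_loc f x \<partial>gauss_measure) \<le> ennreal (C * H1_norm f)"
proof -
  obtain C where "0 < C" and C: "\<And>a :: real ^ 'n \<Rightarrow> complex. gauss_atom a \<Longrightarrow>
      (\<integral>\<^sup>+x. M_loc a x \<partial>gauss_measure) \<le> ennreal C"
    using nn_integral_M_loc_atom_bounded by blast
  show ?thesis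
  proof (intro exI[of _ C] ballI)
    fix f :: "real ^ 'n \<Rightarrow> complex" assume "f \<in> H1_gauss"
    then obtain l0 a0 where f: "integrable gauss_measure f" and rep0: "atomic_rep f l0 a0"
      by (auto simp: H1_gauss_def)
    let ?I = "\<integral>\<^sup>+x. M_loc f x \<partial>gauss_measure"
    note le = nn_integral_M_loc_le_of_atomic_rep[OF f _ less_imp_le[OF \<open>0 < C\<close>] C]
    have fin: "?I < \<infinity>"
      using le[OF rep0] by (simp add: order_le_less_trans)
    then obtain m where m: "?I = ennreal m" "0 \<le> m" by (cases ?I) auto
    \<comment> \<open>After division by \<open>C\<close> the bound is a lower bound of the set whose infimum is the norm.\<close>
    have "m / C \<le> H1_norm f"
      unfolding H1_norm_def
    proof (rule cInf_greatest)
      show "{(\<Sum>j. norm (l j)) | l a. atomic_rep f l a} \<noteq> {}" using rep0 by blast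
      fix s assume "s \<in> {(\<Sum>j. norm (l j)) | l a. atomic_rep f l a}"
      then obtain l a where s: "s = (\<Sum>j. norm (l j))" and rep: "atomic_rep f l a" by blast
      have "0 \<le> s" unfolding s using rep by (intro suminf_nonneg) (auto simp: atomic_rep_def)
      then have "m \<le> C * s" using le[OF rep] m \<open>0 < C\<close> by (simp add: s)
      then show "m / C \<le> s" using \<open>0 < C\<close> by (simp add: field_simps)
    qed
    then have "?I \<le> ennreal (C * H1_norm f)"
      using m \<open>0 < C\<close> by (simp add: field_simps ennreal_leI)
    then show "M_loc f \<in> borel_measurable gauss_measure \<and> ?I < \<infinity> \<and> ?I \<le> ennreal (C * H1_norm f)"
      using fin borel_measurable_M_loc[OF f] by simp
  qed
qed

end
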